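(* Let $\mu_1,\mu_2\in[0,\infty)$, let $f_1\in\mathcal{F}_{\mu_1,\infty}(\mathbb{R}^n)$ and $f_2\in\mathcal{F}_{\mu_2,\infty}(\mathbb{R}^n)$ (no smoothness is required of either function), let $f=f_1-f_2$ be lower semicontinuous and bounded below, and let $f^\star\in\mathbb{R}$ be a lower bound of $f$ on $\mathbb{R}^n$. Let $N\ge1$ and let $x^1,\dots,x^{N+1}$ and $g_2^k\in\partial f_2(x^k)$ ($1\le k\le N$) be generated by $N$ iterations of the DCA started at $x^1$. Then $$\min_{1\leq k\leq N} \Bigl(f_1(x^k)-f_1(x^{k+1})-\langle g_2^k, x^k-x^{k+1}\rangle\Bigr)\leq \frac{1}{N} \left(f(x^1)-f^\star \right).$$
   Context: $\|\cdot\|$ and $\langle\cdot,\cdot\rangle$ are the Euclidean norm and inner product on $\mathbb{R}^n$. For an extended-valued convex function $h$, $\partial h(x)=\{g: h(y)\ge h(x)+\langle g,y-x\rangle\ \forall y\in\mathbb{R}^n\}$ for $x$ with $h(x)<\infty$. $\mathcal{F}_{\mu,\infty}(\mathbb{R}^n)$ is the set of closed proper convex functions $h:\mathbb{R}^n\to(-\infty,\infty]$ that are $\mu$-strongly convex, i.e. such that $x\mapsto h(x)-\frac{\mu}{2}\|x\|^2$ is convex. The difference $f_1-f_2$ is taken to be $+\infty$ wherever $f_1=+\infty$. DCA (Difference-of-Convex Algorithm): starting from $x^1\in\mathbb{R}^n$, for $k=1,2,\dots$ choose $g_2^k\in\partial f_2(x^k)$ and then choose $x^{k+1}\in\operatorname{argmin}_{x\in\mathbb{R}^n}\,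 f_1(x)-f_2(x^k)-\langle g_2^k,x-x^k\rangle$. It is assumed that the iterates exist and that $\partial f_1(x^k)\neq\emptyset$ and $\partial f_2(x^k)\ne\emptyset$ for all $k$. *)

theory Defs
  imports "HOL-Analysis.Analysis"
begin

definition ereal_epigraph :: "('a \<Rightarrow> ereal) \<Rightarrow> ('a \<times> real) set" where
  "ereal_epigraph h = {(x, t). h x \<le> ereal t}"

definition proper_fun :: "('a \<Rightarrow> ereal) \<Rightarrow> bool" where
  "proper_fun h \<longleftrightarrow> (\<forall>x. h x \<noteq> -\<infinity>) \<and> (\<exists>x. h x \<noteq> \<infinity>)"

definition ereal_convex :: "('a::real_vector \<Rightarrow> ereal) \<Rightarrow> bool" where
  "ereal_convex h \<longleftrightarrow> convex (ereal_epigraph h)"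

definition closed_fun :: "('a::topological_space \<Rightarrow> ereal) \<Rightarrow> bool" where
  "closed_fun h \<longleftrightarrow> closed (ereal_epigraph h)"

definition lower_semicontinuous :: "('a::topological_space \<Rightarrow> ereal) \<Rightarrow> bool" where
  "lower_semicontinuous h \<longleftrightarrow> (\<forall>x. h x \<le> Liminf (at x) h)"

(* The class F_{mu,infinity}: mu-strongly convex, no upper curvature bound. *)
definition strongly_convex_class :: "real \<Rightarrow> ((real ^ 'n) \<Rightarrow> ereal) set" where
  "strongly_convex_class \<mu> =
     {h. closed_fun h \<and> proper_fun h \<and> ereal_convex h \<and>
         ereal_convex (\<lambda>x. h x - ereal (\<mu> / 2 * (norm x)\<^sup>2))}"

(* Empty at points where h takes the value infinity. *)
definition subdifferential :: "((real ^ 'n) \<Rightarrow> ereal) \<Rightarrow> real ^ 'n \<Rightarrow> (real ^ 'n) set" where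
  "subdifferential h x = {g. h x < \<infinity> \<and> (\<forall>y. h x + ereal (g \<bullet> (y - x)) \<le> h y)}"

(* The difference f1 - f2, with value infinity wherever f1 is infinite
   (in particular where both functions are infinite). *)
definition dc_diff :: "('a \<Rightarrow> ereal) \<Rightarrow> ('a \<Rightarrow> ereal) \<Rightarrow> 'a \<Rightarrow> ereal" where
  "dc_diff f1 f2 x = (if f1 x = \<infinity> then \<infinity> else f1 x - f2 x)"

(* N iterations of the DCA, with iterates x 1, ..., x (N + 1) and chosen subgradients
   g 1, ..., g N; other values of the sequences x and g are irrelevant. *)
definition dca_iterates ::
  "((real ^ 'n) \<Rightarrow> ereal) \<Rightarrow> ((real ^ 'n) \<Rightarrow> ereal) \<Rightarrow> nat \<Rightarrow>
   (nat \<Rightarrow> real ^ 'n) \<Rightarrow> (nat \<Rightarrow> real ^ 'n) \<Rightarrow> bool" where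
  "dca_iterates f1 f2 N x g \<longleftrightarrow>
     (\<forall>k\<in>{1..N}. g k \<in> subdifferential f2 (x k) \<and>
        is_arg_min (\<lambda>y. f1 y - f2 (x k) - ereal (g k \<bullet> (y - x k))) (\<lambda>_. True) (x (k + 1)))"

end

theory Submission
  imports Defs
begin

text \<open>The subgradient inequality of \<open>f2\<close> at \<open>x k\<close>, tested at \<open>x (k + 1)\<close>, says that replacing
  \<open>f2\<close> by its linearization at \<open>x k\<close> only underestimates \<open>f2 (x (k + 1))\<close>. Hence the gap
  \<open>f1 (x k) - f1 (x (k + 1)) - g k \<bullet> (x k - x (k + 1))\<close> is at most the decrease of
  \<open>f = f1 - f2\<close> in step \<open>k\<close>. These decreases telescope to \<open>f (x 1) - f (x (N + 1))\<close>, which is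
  at most \<open>f (x 1) - fstar\<close>, and the smallest of the \<open>N\<close> gaps is at most their average.

  The computation takes place in the reals: a point with a subgradient of a proper
  function has a finite function value, so every value that occurs is a real number.\<close>

lemma finite_at_subgradient_point:
  assumes "proper_fun h" and "subdifferential h z \<noteq> {}"
  shows "h z = ereal (real_of_ereal (h z))"
proof -
  have "\<bar>h z\<bar> \<noteq> \<infinity>"
    using assms by (auto simp: proper_fun_def subdifferential_def)
  then show ?thesis
    by (simp add: ereal_real)
qed

text \<open>Otherwise all \<open>N\<close> of the \<open>d k\<close> would exceed the average decrease \<open>(F 1 - c) / N\<close>, although
  their sum is at most \<open>F 1 - F (N + 1)\<close> and hence at most \<open>F 1 - c\<close>.\<close>

lemma ex_le_average_of_telescoping_bound:
  fixes d F :: "nat \<Rightarrow> real"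
  assumes "1 \<le> N"
    and step: "\<And>k. k \<in> {1..N} \<Longrightarrow> d k \<le> F k - F (k + 1)"
    and "c \<le> F (N + 1)"
  shows "\<exists>k\<in>{1..N}. d k \<le> (F 1 - c) / real N"
proof (rule ccontr)
  assume "\<not> ?thesis"
  then have above: "(F 1 - c) / real N < d k" if "k \<in> {1..N}" for k
    using that by (meson not_le)
  have "(\<Sum>k=1..N. (F 1 - c) / real N) < (\<Sum>k=1..N. d k)"
    using \<open>1 \<le> N\<close> by (intro sum_strict_mono above) auto
  also have "\<dots> \<le> (\<Sum>k=1..N. F k - F (k + 1))"
    by (intro sum_mono step)
  also have "\<dots> = F 1 - F (N + 1)"
    using sum_Suc_diff[of 1 N "\<lambda>k. - F k"] by simp
  also have "\<dots> \<le> F 1 - c"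
    using assms(3) by simp
  finally show False
    using \<open>1 \<le> N\<close> by simp
qed

theorem corollary4p1:
  fixes \<mu>1 \<mu>2 fstar :: real
    and f1 f2 :: "real ^ 'n \<Rightarrow> ereal"
    and N :: nat
    and x g :: "nat \<Rightarrow> real ^ 'n"
  assumes "0 \<le> \<mu>1" and "0 \<le> \<mu>2"
    and "f1 \<in> strongly_convex_class \<mu>1"
    and "f2 \<in> strongly_convex_class \<mu>2"
    and "lower_semicontinuous (dc_diff f1 f2)"
    and "\<And>y. ereal fstar \<le> dc_diff f1 f2 y"
    and "1 \<le> N"
    and "dca_iterates f1 f2 N x g"
    and "\<And>k. k \<in> {1..N + 1} \<Longrightarrow> subdifferential f1 (x k) \<noteq> {}"
    and "\<And>k. k \<in> {1..N + 1} \<Longrightarrow> subdifferential f2 (x k) \<noteq> {}"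
  shows "(MIN k\<in>{1..N}. f1 (x k) - f1 (x (k + 1)) - ereal (g k \<bullet> (x k - x (k + 1))))
           \<le> ereal (1 / real N) * (dc_diff f1 f2 (x 1) - ereal fstar)"
proof -
  define a b where "a k = real_of_ereal (f1 (x k))" and "b k = real_of_ereal (f2 (x k))" for k
  have proper: "proper_fun f1" "proper_fun f2"
    using assms(3,4) by (auto simp: strongly_convex_class_def)
  have f1: "f1 (x k) = ereal (a k)" and f2: "f2 (x k) = ereal (b k)" if "k \<in> {1..N + 1}" for k
    unfolding a_def b_def
    using that assms(9,10) proper by (blast intro: finite_at_subgradient_point)+
  have f: "dc_diff f1 f2 (x k) = ereal (a k - b k)" if "k \<in> {1..N + 1}" for k
    using f1[OF that] f2[OF that] by (simp add: dc_diff_def)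
  define d where "d k = a k - a (k + 1) - g k \<bullet> (x k - x (k + 1))" for k
  have gap: "f1 (x k) - f1 (x (k + 1)) - ereal (g k \<bullet> (x k - x (k + 1))) = ereal (d k)"
    if "k \<in> {1..N}" for k
    using that f1[of k] f1[of "k + 1"] by (simp add: d_def)
  have decrease: "d k \<le> (a k - b k) - (a (k + 1) - b (k + 1))" if "k \<in> {1..N}" for k
  proof -
    have "f2 (x k) + ereal (g k \<bullet> (x (k + 1) - x k)) \<le> f2 (x (k + 1))"
      using assms(8) that by (auto simp: dca_iterates_def subdifferential_def)
    then have "b k + g k \<bullet> (x (k + 1) - x k) \<le> b (k + 1)"
      using that f2[of k] f2[of "k + 1"] by simp
    then show ?thesis
      by (simp add: d_def inner_diff_right)
  qed
  have "fstar \<le> a (N + 1) - b (N + 1)"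
    using assms(6)[of "x (N + 1)"] f[of "N + 1"] by simp
  then obtain k where k: "k \<in> {1..N}" "d k \<le> (a 1 - b 1 - fstar) / real N"
    using ex_le_average_of_telescoping_bound[of N d "\<lambda>k. a k - b k" fstar]
      \<open>1 \<le> N\<close> decrease by auto
  have "(MIN k\<in>{1..N}. f1 (x k) - f1 (x (k + 1)) - ereal (g k \<bullet> (x k - x (k + 1)))) \<le> ereal (d k)"
    using k(1) gap[OF k(1), symmetric] by (simp only:) (intro Min_le finite_imageI imageI finite_atLeastAtMost)
  also have "\<dots> \<le> ereal ((a 1 - b 1 - fstar) / real N)"
    using k(2) by simp
  also have "\<dots> = ereal (1 / real N) * (dc_diff f1 f2 (x 1) - ereal fstar)"
    using f[of 1] by simp
  finally show ?thesis .
qed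

end
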